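(* Let $G$ be a connected graph of order $n$ with Laplacian matching roots $\lambda_1\ge\lambda_2\ge\cdots\ge\lambda_n$, and let $v_i,v_j$ be two nonadjacent vertices of $G$; put $e=v_iv_j$. Suppose there is an index $k\in\{2,\ldots,n\}$ such that the multiset of Laplacian matching roots of $G+e$ is $\{\lambda_1+1,\lambda_k+1\}\cup\{\lambda_\ell:\ \ell\neq 1,k\}$. Then, with $d(\cdot)$ denoting degrees in $G$, $$\lambda_1+\lambda_k=d(v_i)+d(v_j)+1,\qquad \lambda_1\lambda_k=d(v_i)d(v_j).$$
   Context: All graphs are finite, simple and undirected. For a graph $G$, $d(v)$ is the degree of $v$ and $\mathcal{M}(G)$ the set of matchings of $G$ (including the empty one); $V(M)$ is the set of endpoints of edges of a matching $M$. The Laplacian matching polynomial is $\mathscr{LM}(G,x)=\sum_{M\in\mathcal{M}(G)}(-1)^{|M|}\prod_{v\in V(G)\setminus V(M)}(x-d(v))$; its roots are real and nonnegative and are called the Laplacian matching roots, listed with multiplicity in nonincreasing order. $G+e$ is $G$ with the new edge $e$ added. *)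

theory Defs
  imports "HOL-Computational_Algebra.Polynomial" "HOL-Library.Multiset"
begin

definition simple_graph :: "'a set \<Rightarrow> 'a set set \<Rightarrow> bool" where
  "simple_graph V E \<longleftrightarrow> finite V \<and> (\<forall>e\<in>E. e \<subseteq> V \<and> card e = 2)"

definition graph_connected :: "'a set \<Rightarrow> 'a set set \<Rightarrow> bool" where
  "graph_connected V E \<longleftrightarrow> V \<noteq> {} \<and> (\<forall>u\<in>V. \<forall>v\<in>V. (u, v) \<in> {(x, y). {x, y} \<in> E}\<^sup>*)"

definition vdeg :: "'a set set \<Rightarrow> 'a \<Rightarrow> nat" where
  "vdeg E v = card {e \<in> E. v \<in> e}"

definition matchings :: "'a set set \<Rightarrow> 'a set set set" where
  "matchings E = {M. M \<subseteq> E \<and> pairwise disjnt M}"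

definition laplacian_matching_poly :: "'a set \<Rightarrow> 'a set set \<Rightarrow> real poly" where
  "laplacian_matching_poly V E =
     (\<Sum>M\<in>matchings E. (- 1) ^ card M * (\<Prod>v\<in>V - \<Union>M. [:- real (vdeg E v), 1:]))"

text \<open>The multiset of real roots. Real-rootedness makes this the multiset of all complex roots.\<close>

definition laplacian_matching_roots :: "'a set \<Rightarrow> 'a set set \<Rightarrow> real multiset" where
  "laplacian_matching_roots V E = proots (laplacian_matching_poly V E)"

end

theory Submission
  imports Defs
begin

text \<open>
  By Newton's identities the first three power sums of the Laplacian matching roots depend only on
  the top four coefficients of the polynomial, to which only matchings with at most one edge
  contribute. They equal \<open>\<Sum>d(v)\<close>, \<open>\<Sum>d(v)\<^sup>2 + \<Sum>d(v)\<close> and \<open>\<Sum>d(v)\<^sup>3 + 3 \<Sum>d(v)\<^sup>2\<close>. Comparing the second and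
  third power sums before and after adding the edge determines \<open>\<lambda>\<^sub>1 + \<lambda>\<^sub>k\<close> and then
  \<open>\<lambda>\<^sub>1\<^sup>2 + \<lambda>\<^sub>k\<^sup>2\<close>.
\<close>

section \<open>Power sums and coefficients\<close>

abbreviation power_sum :: "nat \<Rightarrow> real multiset \<Rightarrow> real" where
  "power_sum j A \<equiv> (\<Sum>x\<in>#A. x ^ j)"

lemma coeff_linear_mult:
  fixes a b :: "'a::comm_semiring_1"
  shows "coeff ([:a, b:] * q) (Suc i) = a * coeff q (Suc i) + b * coeff q i"
  by (simp add: mult_pCons_left)

text \<open>The coefficient of \<open>q\<close> at \<open>i\<close> is (-1)^i times the i-th
  elementary symmetric function of \<open>A\<close>. With factors 1 - x t in place of t - x these
  positions do not depend on the size of \<open>A\<close>, so adding a root y just turns c_i into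
  c_i - y c_(i-1). The factors 2 and 6 clear denominators.\<close>

lemma newton_identities_prod_linear:
  fixes A :: "real multiset"
  defines "q \<equiv> (\<Prod>x\<in>#A. [:1, - x:])"
  shows "coeff q 0 = 1"
    and "coeff q 1 = - power_sum 1 A"
    and "2 * coeff q 2 = (power_sum 1 A)\<^sup>2 - power_sum 2 A"
    and "6 * coeff q 3 = - ((power_sum 1 A) ^ 3 - 3 * power_sum 1 A * power_sum 2 A + 2 * power_sum 3 A)"
proof -
  have "coeff q 0 = 1 \<and> coeff q 1 = - power_sum 1 A
    \<and> 2 * coeff q 2 = (power_sum 1 A)\<^sup>2 - power_sum 2 A
    \<and> 6 * coeff q 3 = - ((power_sum 1 A) ^ 3 - 3 * power_sum 1 A * power_sum 2 A + 2 * power_sum 3 A)"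
    unfolding q_def
  proof (induction A)
    case empty
    then show ?case by simp
  next
    case (add y A)
    define r where "r = (\<Prod>x\<in>#A. [:1, - x:])"
    have prod: "(\<Prod>x\<in>#add_mset y A. [:1, - x:]) = [:1, - y:] * r"
      by (simp add: r_def)
    have c0: "coeff ([:1, - y:] * r) 0 = coeff r 0"
      by (simp add: coeff_mult_0)
    have c1: "coeff ([:1, - y:] * r) 1 = coeff r 1 - y * coeff r 0"
      using coeff_linear_mult[of 1 "- y" r 0] by simp
    have c2: "coeff ([:1, - y:] * r) 2 = coeff r 2 - y * coeff r 1"
      using coeff_linear_mult[of 1 "- y" r 1] by (simp add: numeral_2_eq_2)
    have c3: "coeff ([:1, - y:] * r) 3 = coeff r 3 - y * coeff r 2"
      using coeff_linear_mult[of 1 "- y" r 2] by (simp add: numeral_3_eq_3 numeral_2_eq_2)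
    have P: "power_sum j (add_mset y A) = y ^ j + power_sum j A" for j
      by simp
    have r: "coeff r 0 = 1" "coeff r 1 = - power_sum 1 A"
      "2 * coeff r 2 = (power_sum 1 A)\<^sup>2 - power_sum 2 A"
      "6 * coeff r 3 = - ((power_sum 1 A) ^ 3 - 3 * power_sum 1 A * power_sum 2 A + 2 * power_sum 3 A)"
      using add.IH unfolding r_def by blast+
    show ?case
      unfolding prod c0 c1 c2 c3 P
    proof (intro conjI)
      show "coeff r 0 = 1" by (rule r)
      show "coeff r 1 - y * coeff r 0 = - (y ^ 1 + power_sum 1 A)"
        using r by simp
      show "2 * (coeff r 2 - y * coeff r 1) = (y ^ 1 + power_sum 1 A)\<^sup>2 - (y\<^sup>2 + power_sum 2 A)"
        using r(3) unfolding right_diff_distrib r(2) by (simp add: power2_eq_square algebra_simps)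
      \<comment> \<open>Writing 6 as 3 * 2 exposes \<open>2 * coeff r 2\<close>, the form in which
        the induction hypothesis gives this coefficient.\<close>
      have "6 * (coeff r 3 - y * coeff r 2) = 6 * coeff r 3 - 3 * y * (2 * coeff r 2)"
        by simp
      also have "\<dots> = - ((y ^ 1 + power_sum 1 A) ^ 3 - 3 * (y ^ 1 + power_sum 1 A) * (y\<^sup>2 + power_sum 2 A)
          + 2 * (y ^ 3 + power_sum 3 A))"
        unfolding r(3,4) by (simp add: power2_eq_square power3_eq_cube algebra_simps)
      finally show "6 * (coeff r 3 - y * coeff r 2)
        = - ((y ^ 1 + power_sum 1 A) ^ 3 - 3 * (y ^ 1 + power_sum 1 A) * (y\<^sup>2 + power_sum 2 A)
          + 2 * (y ^ 3 + power_sum 3 A))" .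
    qed
  qed
  then show "coeff q 0 = 1"
    and "coeff q 1 = - power_sum 1 A"
    and "2 * coeff q 2 = (power_sum 1 A)\<^sup>2 - power_sum 2 A"
    and "6 * coeff q 3 = - ((power_sum 1 A) ^ 3 - 3 * power_sum 1 A * power_sum 2 A + 2 * power_sum 3 A)"
    by blast+
qed

text \<open>The assumption says that all roots lie in the domain. It survives division by a linear
  factor, since the degree and the number of roots both drop by one.\<close>

lemma splits_over_proots:
  fixes p :: "'a::idom poly"
  assumes "size (proots p) = degree p"
  shows "p = smult (lead_coeff p) (\<Prod>x\<in>#proots p. [:- x, 1:])"
  using assms
proof (induction "degree p" arbitrary: p)
  case 0
  then show ?case by (auto elim: degree_eq_zeroE)
next
  case (Suc m)
  then have "p \<noteq> 0" by auto
  from Suc have "proots p \<noteq> {#}" by auto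
  then obtain x where "x \<in># proots p" by blast
  with \<open>p \<noteq> 0\<close> have "poly p x = 0" by simp
  then obtain q where p: "p = [:- x, 1:] * q"
    by (auto simp: poly_eq_0_iff_dvd)
  with \<open>p \<noteq> 0\<close> have "q \<noteq> 0" by auto
  have deg: "degree p = Suc (degree q)"
    unfolding p using \<open>q \<noteq> 0\<close> by (subst degree_mult_eq) auto
  have roots: "proots p = add_mset x (proots q)"
    unfolding p using \<open>q \<noteq> 0\<close> by (subst proots_mult) auto
  have lead: "lead_coeff p = lead_coeff q"
    unfolding p by (simp only: lead_coeff_mult) simp
  have "q = smult (lead_coeff q) (\<Prod>y\<in>#proots q. [:- y, 1:])"
    using Suc deg roots by auto
  then have "p = [:- x, 1:] * smult (lead_coeff q) (\<Prod>y\<in>#proots q. [:- y, 1:])"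
    using p by argo
  then show ?case unfolding roots lead by (simp only: image_mset_add_mset prod_mset.add_mset mult_smult_right)
qed

lemma reflect_poly_prod_mset_linear:
  fixes A :: "'a::idom multiset"
  shows "reflect_poly (\<Prod>x\<in>#A. [:- x, 1:]) = (\<Prod>x\<in>#A. [:1, - x:])"
proof (induction A)
  case (add y A)
  have "reflect_poly [:- y, 1:] = [:1, - y:]"
    by (simp add: reflect_poly_def)
  with add show ?case
    by (simp only: image_mset_add_mset prod_mset.add_mset reflect_poly_mult)
qed simp

section \<open>The leading coefficients of the Laplacian matching polynomial\<close>

lemma simple_graph_finite_edges:
  assumes "simple_graph V E" shows "finite E"
  using assms finite_subset[of E "Pow V"] by (auto simp: simple_graph_def)

lemma finite_matchings: "finite E \<Longrightarrow> finite (matchings E)"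
  by (rule finite_subset[of _ "Pow E"]) (auto simp: matchings_def)

lemma Union_matching_subset:
  "simple_graph V E \<Longrightarrow> M \<in> matchings E \<Longrightarrow> \<Union>M \<subseteq> V"
  by (auto simp: simple_graph_def matchings_def)

lemma card_Union_matching:
  assumes "simple_graph V E" "M \<in> matchings E"
  shows "card (\<Union>M) = 2 * card M"
proof -
  have card2: "card e = 2" if "e \<in> M" for e
    using assms that by (auto simp: simple_graph_def matchings_def)
  have "card (\<Union>M) = sum card M"
  proof (rule card_Union_disjoint)
    show "pairwise disjnt M" using assms by (simp add: matchings_def)
    show "finite e" if "e \<in> M" for e
      using card2[OF that] card.infinite by fastforce
  qed
  with card2 show ?thesis by simp
qed

text \<open>Double counting of the incidences between vertices and edges, each weighted by its
  vertex.\<close>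

lemma sum_edges_eq_sum_vdeg:
  fixes g :: "'a \<Rightarrow> real"
  assumes "simple_graph V E"
  shows "(\<Sum>e\<in>E. \<Sum>v\<in>e. g v) = (\<Sum>v\<in>V. real (vdeg E v) * g v)"
proof -
  have fin: "finite V" "finite E"
    using assms simple_graph_finite_edges by (auto simp: simple_graph_def)
  have "(\<Sum>e\<in>E. \<Sum>v\<in>e. g v) = (\<Sum>e\<in>E. \<Sum>v\<in>V. if v \<in> e then g v else 0)"
  proof (rule sum.cong[OF refl])
    fix e assume "e \<in> E"
    then have "e = {v \<in> V. v \<in> e}" using assms by (auto simp: simple_graph_def)
    then show "(\<Sum>v\<in>e. g v) = (\<Sum>v\<in>V. if v \<in> e then g v else 0)"
      using sum.inter_filter[OF fin(1), of g "\<lambda>v. v \<in> e"] by simp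
  qed
  also have "\<dots> = (\<Sum>v\<in>V. \<Sum>e\<in>E. if v \<in> e then g v else 0)"
    by (rule sum.swap)
  also have "\<dots> = (\<Sum>v\<in>V. real (vdeg E v) * g v)"
    by (simp add: vdeg_def flip: sum.inter_filter[OF fin(2)])
  finally show ?thesis .
qed

lemma handshake:
  assumes "simple_graph V E"
  shows "(\<Sum>v\<in>V. real (vdeg E v)) = 2 * real (card E)"
proof -
  have "(\<Sum>v\<in>V. real (vdeg E v)) = (\<Sum>e\<in>E. \<Sum>v\<in>e. 1)"
    using sum_edges_eq_sum_vdeg[OF assms, of "\<lambda>_. 1"] by simp
  also have "\<dots> = (\<Sum>e\<in>E. 2)"
    using assms by (intro sum.cong) (auto simp: simple_graph_def)
  finally show ?thesis by simp
qed

text \<open>A matching M contributes degree |V| - 2|M|, so the top degree comes from the empty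
  matching alone, whose term is a product of monic linear factors.\<close>

lemma laplacian_matching_poly_monic:
  assumes "simple_graph V E"
  shows "degree (laplacian_matching_poly V E) = card V"
    and "lead_coeff (laplacian_matching_poly V E) = 1"
proof -
  let ?t = "\<lambda>M. (- 1) ^ card M * (\<Prod>v\<in>V - \<Union>M. [:- real (vdeg E v), 1:])"
  have fin: "finite V" "finite (matchings E)"
    using assms finite_matchings simple_graph_finite_edges by (auto simp: simple_graph_def)
  have empty: "{} \<in> matchings E" by (simp add: matchings_def)
  have split: "laplacian_matching_poly V E = ?t {} + (\<Sum>M\<in>matchings E - {{}}. ?t M)"
    unfolding laplacian_matching_poly_def by (rule sum.remove[OF fin(2) empty])
  have deg: "degree (?t M) \<le> card (V - \<Union>M)" for M
  proof -
    have "degree (?t M) = degree (\<Prod>v\<in>V - \<Union>M. [:- real (vdeg E v), 1:])"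
      by (cases "even (card M)") simp_all
    also have "\<dots> = card (V - \<Union>M)"
      by (subst degree_prod_sum_eq) auto
    finally show ?thesis by simp
  qed
  have deg_empty: "degree (?t {}) = card V"
    by (simp add: degree_prod_sum_eq)
  have lead_empty: "lead_coeff (?t {}) = 1"
    by (simp add: lead_coeff_prod)
  have less: "degree (?t M) < card V" if M: "M \<in> matchings E - {{}}" for M
  proof -
    have "M \<subseteq> E" using M by (auto simp: matchings_def)
    then have "finite M" using simple_graph_finite_edges[OF assms] finite_subset by blast
    with M have "card M > 0" by (simp add: card_gt_0_iff)
    with card_Union_matching[OF assms, of M] M have "card (\<Union>M) > 0" by simp
    moreover have "card (V - \<Union>M) = card V - card (\<Union>M)"
      using Union_matching_subset[OF assms, of M] M fin by (intro card_Diff_subset) (auto intro: finite_subset)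
    moreover have "card (\<Union>M) \<le> card V"
      using Union_matching_subset[OF assms, of M] M fin by (intro card_mono) auto
    ultimately show ?thesis using deg[of M] by linarith
  qed
  define r where "r = (\<Sum>M\<in>matchings E - {{}}. ?t M)"
  \<comment> \<open>The alternative \<open>r = 0\<close> covers the empty vertex set, where no
    degree lies strictly below \<open>card V\<close>.\<close>
  have r: "r = 0 \<or> degree r < card V"
  proof (cases "matchings E - {{}} = {}")
    case True
    then show ?thesis by (simp only: r_def sum.empty simp_thms)
  next
    case False
    then have "card V > 0" using less by fastforce
    then show ?thesis unfolding r_def using less by (intro disjI2 degree_sum_less) auto
  qed
  show deg_L: "degree (laplacian_matching_poly V E) = card V"
    unfolding split r_def[symmetric] using r deg_empty by (metis add.right_neutral degree_add_eq_left)
  have "coeff r (card V) = 0"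
    using r by (auto intro: coeff_eq_0)
  then show "lead_coeff (laplacian_matching_poly V E) = 1"
    using lead_empty unfolding deg_L deg_empty unfolding split r_def[symmetric] by simp
qed

text \<open>Reflection brings the top coefficients to the bottom. It is not additive when degrees
  differ: the monomial makes up for the degree 2|M| that the term of M lacks. The identity is
  therefore checked by evaluation at 1/t.\<close>

lemma reflect_laplacian_matching_poly:
  assumes "simple_graph V E"
  shows "reflect_poly (laplacian_matching_poly V E) =
    (\<Sum>M\<in>matchings E. (- 1) ^ card M * (monom 1 (2 * card M) * (\<Prod>v\<in>V - \<Union>M. [:1, - real (vdeg E v):])))"
    (is "?L = ?R")
proof (rule ccontr)
  have fin: "finite V" using assms by (simp add: simple_graph_def)
  have eq: "poly ?L t = poly ?R t" if "t \<noteq> 0" for t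
  proof -
    \<comment> \<open>One factor t goes to each uncovered vertex; the 2|M| covered vertices leave
      the monomial.\<close>
    have scaled: "t ^ card V * (\<Prod>v\<in>V - \<Union>M. inverse t - real (vdeg E v))
        = t ^ (2 * card M) * (\<Prod>v\<in>V - \<Union>M. 1 - t * real (vdeg E v))" if M: "M \<in> matchings E" for M
    proof -
      have sub: "\<Union>M \<subseteq> V" by (rule Union_matching_subset[OF assms M])
      have "card V = card (\<Union>M) + card (V - \<Union>M)"
        using fin sub by (simp add: card_Diff_subset card_mono finite_subset)
      then have "t ^ card V = t ^ (2 * card M) * (\<Prod>v\<in>V - \<Union>M. t)"
        using card_Union_matching[OF assms M] by (simp add: power_add)
      then have "t ^ card V * (\<Prod>v\<in>V - \<Union>M. inverse t - real (vdeg E v))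
          = t ^ (2 * card M) * (\<Prod>v\<in>V - \<Union>M. t * (inverse t - real (vdeg E v)))"
        by (simp add: prod.distrib)
      with \<open>t \<noteq> 0\<close> show ?thesis by (simp add: right_diff_distrib)
    qed
    have "poly ?L t = t ^ card V * poly (laplacian_matching_poly V E) (inverse t)"
      using that by (simp add: poly_reflect_poly_nz laplacian_matching_poly_monic[OF assms])
    also have "\<dots> = (\<Sum>M\<in>matchings E. (- 1) ^ card M * (t ^ card V * (\<Prod>v\<in>V - \<Union>M. inverse t - real (vdeg E v))))"
      by (simp add: laplacian_matching_poly_def poly_sum poly_prod sum_distrib_left mult.left_commute)
    also have "\<dots> = poly ?R t"
      by (simp add: poly_sum poly_prod poly_monom scaled)
    finally show ?thesis .
  qed
  \<comment> \<open>A nonzero difference would vanish at every nonzero real, hence at infinitely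
    many points.\<close>
  assume "?L \<noteq> ?R"
  then have "finite {t. poly (?L - ?R) t = 0}" by (intro poly_roots_finite) simp
  moreover have "- {0} \<subseteq> {t. poly (?L - ?R) t = 0}" using eq by auto
  ultimately have "finite (- {0 :: real})" using finite_subset by blast
  then show False by (simp add: infinite_UNIV_char_0)
qed

text \<open>The term of a matching M starts at exponent 2|M|, so up to exponent 3 only the empty
  matching and single edges count. The case \<open>i < 2\<close> guards against truncated
  subtraction in \<open>i - 2\<close>.\<close>

lemma coeff_reflect_laplacian_matching_poly:
  assumes "simple_graph V E" "i \<le> 3"
  shows "coeff (reflect_poly (laplacian_matching_poly V E)) i =
    coeff (\<Prod>v\<in>V. [:1, - real (vdeg E v):]) i
    - (if i < 2 then 0 else \<Sum>e\<in>E. coeff (\<Prod>v\<in>V - e. [:1, - real (vdeg E v):]) (i - 2))"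
proof -
  let ?q = "\<lambda>S. \<Prod>v\<in>S. [:1, - real (vdeg E v):]"
  let ?c = "\<lambda>M. (- 1) ^ card M * (if i < 2 * card M then 0 else coeff (?q (V - \<Union>M)) (i - 2 * card M))"
  have fin: "finite E" "finite (matchings E)"
    using assms simple_graph_finite_edges finite_matchings by auto
  have sign: "coeff ((- 1) ^ m * p) i = (- 1) ^ m * coeff p i" for m and p :: "real poly"
    by (cases "even m") simp_all
  have "coeff (reflect_poly (laplacian_matching_poly V E)) i = (\<Sum>M\<in>matchings E. ?c M)"
    unfolding reflect_laplacian_matching_poly[OF assms(1)] coeff_sum
    by (rule sum.cong) (auto simp: sign coeff_monom_mult)
  also have "\<dots> = (\<Sum>M\<in>insert {} ((\<lambda>e. {e}) ` E). ?c M)"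
  proof (rule sum.mono_neutral_right[OF fin(2)])
    show "insert {} ((\<lambda>e. {e}) ` E) \<subseteq> matchings E"
      by (auto simp: matchings_def)
    show "\<forall>M\<in>matchings E - insert {} ((\<lambda>e. {e}) ` E). ?c M = 0"
    proof
      fix M assume M: "M \<in> matchings E - insert {} ((\<lambda>e. {e}) ` E)"
      then have "M \<subseteq> E" by (auto simp: matchings_def)
      then have "finite M" using fin finite_subset by blast
      with M have "card M \<noteq> 0" by simp
      moreover have "card M \<noteq> 1"
        using M \<open>M \<subseteq> E\<close> by (auto simp: card_1_singleton_iff)
      ultimately have "i < 2 * card M" using assms(2) by linarith
      then show "?c M = 0" by simp
    qed
  qed
  also have "\<dots> = ?c {} + (\<Sum>e\<in>E. ?c {e})"
    using fin by (subst sum.insert) (auto simp: sum.reindex inj_on_def)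
  also have "\<dots> = coeff (?q V) i - (if i < 2 then 0 else \<Sum>e\<in>E. coeff (?q (V - e)) (i - 2))"
    by (simp add: sum_negf)
  finally show ?thesis .
qed

text \<open>The size assumption expresses real-rootedness, so that the reflected polynomial is the
  product of 1 - x t over the roots. Its low coefficients are then computed twice by Newton's
  identities, once from the roots and once from the degrees.\<close>

lemma power_sums_laplacian_matching_roots:
  fixes V :: "'a set"
  assumes G: "simple_graph V E" and real_rooted: "size (laplacian_matching_roots V E) = card V"
  defines "S \<equiv> \<lambda>j. \<Sum>v\<in>V. real (vdeg E v) ^ j"
  shows "power_sum 2 (laplacian_matching_roots V E) = S 2 + S 1"
    and "power_sum 3 (laplacian_matching_roots V E) = S 3 + 3 * S 2"
proof -
  let ?R = "laplacian_matching_roots V E"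
  let ?f = "reflect_poly (laplacian_matching_poly V E)"
  let ?q = "\<lambda>T. \<Prod>v\<in>T. [:1, - real (vdeg E v):]"
  define m where "m = real (card E)"
  have fin: "finite V" "finite E"
    using G simple_graph_finite_edges by (auto simp: simple_graph_def)
  have "laplacian_matching_poly V E = (\<Prod>x\<in>#?R. [:- x, 1:])"
    using splits_over_proots[of "laplacian_matching_poly V E"] real_rooted
      laplacian_matching_poly_monic[OF G] by (simp add: laplacian_matching_roots_def)
  then have f: "?f = (\<Prod>x\<in>#?R. [:1, - x:])"
    by (simp add: reflect_poly_prod_mset_linear)
  note roots = newton_identities_prod_linear[of ?R, folded f]
  \<comment> \<open>\<open>D T\<close> is the multiset of degrees over \<open>T\<close>, always
    taken in the whole graph, which puts \<open>?q T\<close> in the shape of Newton's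
    identities.\<close>
  define D where "D = (\<lambda>T. image_mset (\<lambda>v. real (vdeg E v)) (mset_set T))"
  have q: "?q T = (\<Prod>x\<in>#D T. [:1, - x:])" for T
    by (simp add: prod_unfold_prod_mset D_def image_mset.compositionality comp_def)
  have psum: "power_sum j (D T) = (\<Sum>v\<in>T. real (vdeg E v) ^ j)" for j T
    by (simp add: sum_unfold_sum_mset D_def image_mset.compositionality comp_def)
  have degs: "coeff (?q V) 0 = 1" "coeff (?q V) 1 = - S 1"
    "2 * coeff (?q V) 2 = (S 1)\<^sup>2 - S 2"
    "6 * coeff (?q V) 3 = - ((S 1) ^ 3 - 3 * S 1 * S 2 + 2 * S 3)"
    using newton_identities_prod_linear[of "D V"] unfolding q psum S_def by blast+
  have S1: "S 1 = 2 * m"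
    using handshake[OF G] by (simp add: S_def m_def)
  have edge1: "coeff (?q (V - e)) 1 = - (S 1 - (\<Sum>v\<in>e. real (vdeg E v)))" if "e \<in> E" for e
  proof -
    have "e \<subseteq> V" using G that by (simp add: simple_graph_def)
    then show ?thesis
      using newton_identities_prod_linear(2)[of "D (V - e)"] fin
      unfolding q psum S_def by (simp add: sum_diff)
  qed
  have "(\<Sum>e\<in>E. coeff (?q (V - e)) 1) = (\<Sum>e\<in>E. - (S 1 - (\<Sum>v\<in>e. real (vdeg E v))))"
    using edge1 by (rule sum.cong[OF refl])
  \<comment> \<open>By double counting, the endpoint degrees summed over all edges give the sum of
    squared degrees.\<close>
  also have "\<dots> = S 2 - m * S 1"
    using sum_edges_eq_sum_vdeg[OF G, of "\<lambda>v. real (vdeg E v)"]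
    by (simp add: sum_subtractf m_def S_def power2_eq_square)
  finally have edges1: "(\<Sum>e\<in>E. coeff (?q (V - e)) 1) = S 2 - m * S 1" .
  have edges0: "(\<Sum>e\<in>E. coeff (?q (V - e)) 0) = m"
    unfolding q newton_identities_prod_linear(1) by (simp add: m_def)
  have c1: "coeff ?f 1 = - S 1"
    using coeff_reflect_laplacian_matching_poly[OF G, of 1] degs by simp
  have c2: "coeff ?f 2 = coeff (?q V) 2 - m"
    using coeff_reflect_laplacian_matching_poly[OF G, of 2] edges0 by simp
  have c3: "coeff ?f 3 = coeff (?q V) 3 - (S 2 - m * S 1)"
    using coeff_reflect_laplacian_matching_poly[OF G, of 3] edges1 by simp
  have p1: "power_sum 1 ?R = S 1"
    using roots(2) c1 by simp
  show p2: "power_sum 2 ?R = S 2 + S 1"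
    using roots(3) c2 degs(3) p1 S1 by simp
  show "power_sum 3 ?R = S 3 + 3 * S 2"
    \<comment> \<open>The term 3 (S 1)^2 produced by \<open>p2\<close> cancels 6 m (S 1) from
      \<open>c3\<close>, because S 1 = 2 m.\<close>
    using roots(4) c3 degs(4) unfolding p1 p2 S1 by algebra
qed

section \<open>The effect of adding an edge\<close>

lemma vdeg_insert_edge:
  assumes "finite E" "e \<notin> E"
  shows "vdeg (insert e E) v = (if v \<in> e then Suc (vdeg E v) else vdeg E v)"
proof -
  have "{f \<in> insert e E. v \<in> f} = (if v \<in> e then insert e {f \<in> E. v \<in> f} else {f \<in> E. v \<in> f})"
    by auto
  then show ?thesis using assms by (simp add: vdeg_def)
qed

theorem theorem3p2:
  fixes V :: "'a set" and E :: "'a set set" and n k :: nat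
    and lam :: "nat \<Rightarrow> real" and vi vj :: 'a
  assumes "simple_graph V E" and "graph_connected V E" and "card V = n"
    and "\<And>r s. 1 \<le> r \<Longrightarrow> r \<le> s \<Longrightarrow> s \<le> n \<Longrightarrow> lam s \<le> lam r"
    and "laplacian_matching_roots V E = image_mset lam (mset_set {1..n})"
    and "vi \<in> V" and "vj \<in> V" and "vi \<noteq> vj" and "{vi, vj} \<notin> E"
    and "k \<in> {2..n}"
    and "laplacian_matching_roots V (insert {vi, vj} E)
           = {#lam 1 + 1, lam k + 1#} + image_mset lam (mset_set ({1..n} - {1, k}))"
  shows "lam 1 + lam k = real (vdeg E vi) + real (vdeg E vj) + 1
       \<and> lam 1 * lam k = real (vdeg E vi) * real (vdeg E vj)"
proof -
  let ?E' = "insert {vi, vj} E"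
  let ?L = "{1..n} - {1, k}" and ?W = "V - {vi, vj}"
  have G': "simple_graph V ?E'"
    using assms(1,6-8) by (auto simp: simple_graph_def)
  have finV: "finite V" using assms(1) by (simp add: simple_graph_def)
  have "{1..n} = insert 1 (insert k ?L)" "k \<noteq> 1" using assms(10) by auto
  then have "mset_set {1..n} = mset_set (insert 1 (insert k ?L))" "k \<noteq> 1" by simp_all
  then have roots: "laplacian_matching_roots V E = {#lam 1, lam k#} + image_mset lam (mset_set ?L)"
    unfolding assms(5) by simp
  \<comment> \<open>Real-rootedness of both polynomials is read off the hypotheses, which list
    \<open>n\<close> real roots for each graph.\<close>
  have size: "size (laplacian_matching_roots V E) = card V"
    unfolding assms(3,5) by simp
  then have size': "size (laplacian_matching_roots V ?E') = card V"
    unfolding roots assms(11) by simp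
  have degs: "(\<Sum>v\<in>V. g v) = g vi + g vj + (\<Sum>v\<in>?W. g v)" for g :: "'a \<Rightarrow> real"
  proof -
    have "V = insert vi (insert vj ?W)" using assms(6,7) by auto
    then have "(\<Sum>v\<in>V. g v) = (\<Sum>v\<in>insert vi (insert vj ?W). g v)" by simp
    also have "\<dots> = g vi + g vj + (\<Sum>v\<in>?W. g v)"
      using finV assms(8) by simp
    finally show ?thesis .
  qed
  note vdeg' = vdeg_insert_edge[OF simple_graph_finite_edges[OF assms(1)] assms(9)]
  have rest: "(\<Sum>v\<in>?W. real (vdeg ?E' v) ^ j) = (\<Sum>v\<in>?W. real (vdeg E v) ^ j)" for j
    by (rule sum.cong) (auto simp: vdeg')
  have ends: "real (vdeg ?E' vi) = real (vdeg E vi) + 1" "real (vdeg ?E' vj) = real (vdeg E vj) + 1"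
    by (simp_all add: vdeg')
  define a b x y where "a = lam 1" and "b = lam k"
    and "x = real (vdeg E vi)" and "y = real (vdeg E vj)"
  \<comment> \<open>\<open>P\<close> and \<open>W\<close> collect the roots and the degrees that the
    new edge leaves unchanged; they cancel in the comparisons below.\<close>
  define P W where "P = (\<lambda>j. power_sum j (image_mset lam (mset_set ?L)))"
    and "W = (\<lambda>j. \<Sum>v\<in>?W. real (vdeg E v) ^ j)"
  have pair: "power_sum j ({#s, t#} + A) = s ^ j + t ^ j + power_sum j A" for s t j A
    by simp
  note P = power_sums_laplacian_matching_roots[OF assms(1) size,
      unfolded roots pair degs, folded a_def b_def x_def y_def P_def W_def]
  note P' = power_sums_laplacian_matching_roots[OF G' size',
      unfolded assms(11) pair degs rest ends, folded a_def b_def x_def y_def P_def W_def]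
  \<comment> \<open>The second power sum grows by 2(a + b) + 2 on the side of the roots and by 2(x +
    y) + 4 on the side of the degrees.\<close>
  have sum: "a + b = x + y + 1"
    using P(1) P'(1) by (simp add: power2_eq_square algebra_simps)
  have "a\<^sup>2 + b\<^sup>2 + (a + b) = x\<^sup>2 + y\<^sup>2 + 3 * (x + y) + 2"
    using P(2) P'(2) by (simp add: power2_eq_square power3_eq_cube algebra_simps)
  \<comment> \<open>Twice the product is the square of the sum minus the sum of squares.\<close>
  then have "2 * (a * b) = 2 * (x * y)"
    using sum by algebra
  with sum show ?thesis
    by (simp add: a_def b_def x_def y_def)
qed

end
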